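(* Let $S$ be a topological semigroup acting on a completely regular space $X$ endowed with an admissible family of open coverings $\mathcal{O}$, and let $\mathcal{F}$ be a filter basis on the subsets of $S$. Assume that $X$ is a complete admissible space and that the semigroup action $(S,X)$ is $\mathcal{F}$-limit compact. Then, for every $x\in X$, the $\mathcal{F}$-prolongational limit set $J_{\mathcal{F}}(x)$ is nonempty and compact, and the net $(\mathrm{cls}(A\,\mathrm{St}[x,\mathcal{U}]))_{(A,\mathcal{U})\in\mathcal{F}\times\mathcal{O}}$ converges to $J_{\mathcal{F}}(x)$ in $\mathcal{H}(X)$.
   Context: For coverings $\mathcal{U},\mathcal{V}$ of $X$, $\mathcal{V}\leqslant\mathcal{U}$ means $\mathcal{V}$ refines $\mathcal{U}$; $\mathcal{V}\leqslant\frac12\mathcal{U}$ means: for all $V,V'\in\mathcal{V}$ with $V\cap V'\neq\emptyset$ there is $U\in\mathcal{U}$ with $V\cup V'\subset U$. Stars: $\mathrm{St}[Y,\mathcal{U}]=\bigcup\{U\in\mathcal{U}: Y\cap U\neq\emptyset\}$, $\mathrm{St}[x,\mathcal{U}]=\mathrm{St}[\{x\},\mathcal{U}]$. A family $\mathcal{O}$ of open coverings of $X$ is admissible if (1) for any $\mathcal{U},\mathcal{V}\in\mathcal{O}$ there is $\mathcal{W}\in\mathcal{O}$ with $\mathcal{W}\leqslant\frac12\mathcal{U}$ and $\mathcal{W}\leqslant\frac12\mathcal{V}$; and (2) the stars $\mathrm{St}[x,\mathcal{U}]$, $x\in X$, $\mathcal{U}\in\mathcal{O}$, form a basis for the topology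 of $X$. Define $\rho(x,y)=\{\mathcal{U}\in\mathcal{O}: y\in\mathrm{St}[x,\mathcal{U}]\}$. A nonempty $Y\subset X$ is bounded if there is $\mathcal{U}\in\mathcal{O}$ with $\mathcal{U}\in\rho(x,y)$ for all $x,y\in Y$. For nonempty $Y\subset X$, $\mathrm{D}(Y)=\bigcap_{x,y\in Y}\rho(x,y)$ and $\gamma(Y)=\{\mathcal{U}\in\mathcal{O}: Y\text{ admits a finite cover }Y\subset\bigcup_{i=1}^{n}X_{i}\text{ with }\mathcal{U}\in\mathrm{D}(X_{i})\text{ for each }i\}$. A net $(x_{\lambda})$ is $\mathcal{O}$-Cauchy if for each $\mathcal{U}\in\mathcal{O}$ there is $\lambda_{0}$ with $\mathcal{U}\in\rho(x_{\lambda_{1}},x_{\lambda_{2}})$ whenever $\lambda_{1},\lambda_{2}\geq\lambda_{0}$; $X$ is a complete admissible space if every $\mathcal{O}$-Cauchy net converges. $\mathcal{H}(X)$ is the set of nonempty closed subsets of $X$ with the uniform topology of the diagonal uniformity with base the sets $D_{\mathcal{U}}=\bigcup\{\mathrm{B}_{H}(A,\mathcal{U})\times\mathrm{B}_{H}(A,\mathcal{U}):A\in\mathcal{H}(X)\}$, $\mathcal{U}\in\mathcal{O}$, where $\mathrm{B}_{H}(A,\mathcal{U})=\{B\in\mathcal{H}(X): A\subset\mathrm{St}[B,\mathcal{U}],\ B\subset\mathrm{St}[A,\mathcal{U}]\}$. An action of $S$ on $X$ is a continuous map $S\times X\to X$, $(s,x)\mapsto sx$, with $s(tx)=(st)x$.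 For $A\subset S$, $Y\subset X$, $AY=\{sy:s\in A,y\in Y\}$. A filter basis on the subsets of $S$ is a (nonempty) family $\mathcal{F}$ of subsets of $S$ with $\emptyset\notin\mathcal{F}$ such that for $A,B\in\mathcal{F}$ there is $C\in\mathcal{F}$ with $C\subset A\cap B$. The set $\mathcal{F}\times\mathcal{O}$ is directed by: $(A,\mathcal{U})\leq(B,\mathcal{V})$ iff $B\subset A$ and $\mathcal{V}\leqslant\mathcal{U}$. The prolongations are $D_{A}(x)=\bigcap_{\mathcal{U}\in\mathcal{O}}\mathrm{cls}(A\,\mathrm{St}[x,\mathcal{U}])$ and $J_{\mathcal{F}}(x)=\bigcap_{A\in\mathcal{F}}D_{A}(x)$. The action is $\mathcal{F}$-limit compact if for every bounded $Y\subset X$ and every $\mathcal{U}\in\mathcal{O}$ there is $A\in\mathcal{F}$ with $\mathcal{U}\in\gamma(AY)$. *)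

theory Defs
  imports "HOL-Analysis.Analysis"
begin

definition cov_refines :: "'x set set \<Rightarrow> 'x set set \<Rightarrow> bool" where
  "cov_refines \<V> \<U> \<longleftrightarrow> (\<forall>V\<in>\<V>. \<exists>U\<in>\<U>. V \<subseteq> U)"

definition half_refines :: "'x set set \<Rightarrow> 'x set set \<Rightarrow> bool" where
  "half_refines \<V> \<U> \<longleftrightarrow>
     (\<forall>V\<in>\<V>. \<forall>V'\<in>\<V>. V \<inter> V' \<noteq> {} \<longrightarrow> (\<exists>U\<in>\<U>. V \<union> V' \<subseteq> U))"

definition star :: "'x set \<Rightarrow> 'x set set \<Rightarrow> 'x set" where
  "star Y \<U> = \<Union>{U \<in> \<U>. Y \<inter> U \<noteq> {}}"

definition open_covering :: "'x::topological_space set set \<Rightarrow> bool" where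
  "open_covering \<U> \<longleftrightarrow> (\<forall>U\<in>\<U>. open U) \<and> \<Union>\<U> = UNIV"

definition admissible :: "'x::topological_space set set set \<Rightarrow> bool" where
  "admissible \<O> \<longleftrightarrow>
     (\<forall>\<U>\<in>\<O>. open_covering \<U>) \<and>
     (\<forall>\<U>\<in>\<O>. \<forall>\<V>\<in>\<O>. \<exists>\<W>\<in>\<O>. half_refines \<W> \<U> \<and> half_refines \<W> \<V>) \<and>
     topological_basis {star {x} \<U> | x \<U>. \<U> \<in> \<O>}"

definition rho :: "'x set set set \<Rightarrow> 'x \<Rightarrow> 'x \<Rightarrow> 'x set set set" where
  "rho \<O> x y = {\<U> \<in> \<O>. y \<in> star {x} \<U>}"

definition cov_bounded :: "'x set set set \<Rightarrow> 'x set \<Rightarrow> bool" where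
  "cov_bounded \<O> Y \<longleftrightarrow> Y \<noteq> {} \<and> (\<exists>\<U>\<in>\<O>. \<forall>x\<in>Y. \<forall>y\<in>Y. \<U> \<in> rho \<O> x y)"

text \<open>Only meaningful for nonempty \<open>Y\<close>; every use below supplies a nonempty set.\<close>

definition cov_diam :: "'x set set set \<Rightarrow> 'x set \<Rightarrow> 'x set set set" where
  "cov_diam \<O> Y = (\<Inter>x\<in>Y. \<Inter>y\<in>Y. rho \<O> x y)"

definition noncompactness :: "'x set set set \<Rightarrow> 'x set \<Rightarrow> 'x set set set" where
  "noncompactness \<O> Y =
     {\<U> \<in> \<O>. \<exists>\<X>. finite \<X> \<and> Y \<subseteq> \<Union>\<X> \<and> (\<forall>Z\<in>\<X>. Z \<noteq> {} \<and> \<U> \<in> cov_diam \<O> Z)}"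

definition directed_on :: "'i set \<Rightarrow> ('i \<Rightarrow> 'i \<Rightarrow> bool) \<Rightarrow> bool" where
  "directed_on I le \<longleftrightarrow>
     I \<noteq> {} \<and> (\<forall>i\<in>I. le i i) \<and>
     (\<forall>i\<in>I. \<forall>j\<in>I. \<forall>k\<in>I. le i j \<longrightarrow> le j k \<longrightarrow> le i k) \<and>
     (\<forall>i\<in>I. \<forall>j\<in>I. \<exists>k\<in>I. le i k \<and> le j k)"

text \<open>Convergence of a net indexed by a directed set is convergence along its filter of tails.\<close>

definition net_filter :: "'i set \<Rightarrow> ('i \<Rightarrow> 'i \<Rightarrow> bool) \<Rightarrow> 'i filter" where
  "net_filter I le = (INF i\<in>I. principal {j \<in> I. le i j})"

lemma eventually_net_filter:
  assumes "directed_on I le"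
  shows "eventually P (net_filter I le) \<longleftrightarrow> (\<exists>i\<in>I. \<forall>j\<in>I. le i j \<longrightarrow> P j)"
proof -
  have "I \<noteq> {}" using assms by (simp add: directed_on_def)
  moreover have "\<exists>k\<in>I. principal {j \<in> I. le k j} \<le>
      inf (principal {j \<in> I. le a j}) (principal {j \<in> I. le b j})" if "a \<in> I" "b \<in> I" for a b
  proof -
    obtain k where k: "k \<in> I" "le a k" "le b k"
      using assms \<open>a \<in> I\<close> \<open>b \<in> I\<close> unfolding directed_on_def by meson
    have "le a j \<and> le b j" if "j \<in> I" "le k j" for j
      using assms \<open>a \<in> I\<close> \<open>b \<in> I\<close> k that unfolding directed_on_def by meson
    then show ?thesis using k(1) by (intro bexI[of _ k]) auto
  qed
  ultimately show ?thesis
    unfolding net_filter_def by (subst eventually_INF_base) (auto simp: eventually_principal)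
qed

definition cov_Cauchy ::
    "'x set set set \<Rightarrow> 'i set \<Rightarrow> ('i \<Rightarrow> 'i \<Rightarrow> bool) \<Rightarrow> ('i \<Rightarrow> 'x) \<Rightarrow> bool" where
  "cov_Cauchy \<O> I le f \<longleftrightarrow>
     (\<forall>\<U>\<in>\<O>. \<exists>i\<in>I. \<forall>j\<in>I. \<forall>k\<in>I. le i j \<longrightarrow> le i k \<longrightarrow> \<U> \<in> rho \<O> (f j) (f k))"

text \<open>
  A definition cannot quantify over index types, so the index sets range over subsets of one
  sufficiently large type. Lemma \<open>complete_admissible_net\<close> shows that this covers nets indexed by
  directed sets of any type.
\<close>

definition complete_admissible :: "'x::topological_space set set set \<Rightarrow> bool" where
  "complete_admissible \<O> \<longleftrightarrow>
     (\<forall>(I :: ('x set \<times> 'x) set) le f. directed_on I le \<and> cov_Cauchy \<O> I le f \<longrightarrow>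
        (\<exists>l. (f \<longlongrightarrow> l) (net_filter I le)))"

lemma complete_admissible_net:
  fixes I :: "'i set" and f :: "'i \<Rightarrow> 'x::topological_space"
  assumes compl: "complete_admissible \<O>" and dir: "directed_on I le"
    and Cauchy: "cov_Cauchy \<O> I le f"
  shows "\<exists>l. (f \<longlongrightarrow> l) (net_filter I le)"
proof -
  define T where "T i = f ` {j \<in> I. le i j}" for i
  define K where "K = {(T i, z) | i z. i \<in> I \<and> z \<in> T i}"
  define leK where "leK = (\<lambda>(p :: 'x set \<times> 'x) (q :: 'x set \<times> 'x). fst q \<subseteq> fst p)"
  have refl: "le i i" if "i \<in> I" for i
    using dir that by (simp add: directed_on_def)
  have trans: "le i k" if "i \<in> I" "j \<in> I" "k \<in> I" "le i j" "le j k" for i j k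
    using dir that unfolding directed_on_def by meson
  have up: "\<exists>k\<in>I. le i k \<and> le j k" if "i \<in> I" "j \<in> I" for i j
    using dir that unfolding directed_on_def by meson
  have Tf: "f i \<in> T i" if "i \<in> I" for i
    using refl that by (auto simp: T_def)
  have Tmono: "T j \<subseteq> T i" if "i \<in> I" "j \<in> I" "le i j" for i j
    using trans[OF that(1,2) _ that(3)] unfolding T_def by blast
  have K: "(T i, f j) \<in> K" if "i \<in> I" "j \<in> I" "le i j" for i j
    using that by (auto simp: K_def T_def)
  have KT: "\<exists>i\<in>I. fst p = T i \<and> snd p \<in> T i" if "p \<in> K" for p
    using that by (auto simp: K_def)
  have dirK: "directed_on K leK"
    unfolding directed_on_def
  proof (intro conjI ballI)
    obtain i0 where "i0 \<in> I" using dir unfolding directed_on_def by blast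
    then show "K \<noteq> {}" using K refl by blast
    fix p q assume "p \<in> K" "q \<in> K"
    then obtain i j where ij: "i \<in> I" "j \<in> I" "fst p = T i" "fst q = T j"
      using KT by meson
    obtain k where k: "k \<in> I" "le i k" "le j k" using up ij by blast
    show "\<exists>r\<in>K. leK p r \<and> leK q r"
      using K[OF k(1) k(1) refl[OF k(1)]] Tmono ij k by (intro bexI[of _ "(T k, f k)"]) (auto simp: leK_def)
  qed (auto simp: leK_def)
  have "cov_Cauchy \<O> K leK snd"
    unfolding cov_Cauchy_def
  proof
    fix \<U> assume "\<U> \<in> \<O>"
    then obtain i where i: "i \<in> I"
      "\<And>j k. j \<in> I \<Longrightarrow> k \<in> I \<Longrightarrow> le i j \<Longrightarrow> le i k \<Longrightarrow> \<U> \<in> rho \<O> (f j) (f k)"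
      using Cauchy unfolding cov_Cauchy_def by meson
    have *: "snd q \<in> T i" if "q \<in> K" "leK (T i, f i) q" for q
      using KT[OF that(1)] that(2) by (auto simp: leK_def)
    have "\<U> \<in> rho \<O> a b" if "a \<in> T i" "b \<in> T i" for a b
      using that i(2) by (auto simp: T_def)
    with * show "\<exists>p\<in>K. \<forall>q\<in>K. \<forall>r\<in>K. leK p q \<longrightarrow> leK p r \<longrightarrow> \<U> \<in> rho \<O> (snd q) (snd r)"
      using K[OF i(1) i(1) refl[OF i(1)]] by (intro bexI[of _ "(T i, f i)"]) auto
  qed
  with dirK compl obtain l where l: "(snd \<longlongrightarrow> l) (net_filter K leK)"
    unfolding complete_admissible_def by blast
  have "(f \<longlongrightarrow> l) (net_filter I le)"
  proof (rule topological_tendstoI)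
    fix V assume "open V" "l \<in> V"
    then have "eventually (\<lambda>p. snd p \<in> V) (net_filter K leK)"
      using l topological_tendstoD by blast
    then obtain p where p: "p \<in> K" "\<And>q. q \<in> K \<Longrightarrow> leK p q \<Longrightarrow> snd q \<in> V"
      unfolding eventually_net_filter[OF dirK] by blast
    then obtain i where i: "i \<in> I" "fst p = T i" using KT by blast
    have "f j \<in> V" if "j \<in> I" "le i j" for j
      using p(2)[of "(T i, f j)"] K[OF i(1) that] i(2) by (simp add: leK_def)
    then show "eventually (\<lambda>j. f j \<in> V) (net_filter I le)"
      unfolding eventually_net_filter[OF dir] using i(1) by blast
  qed
  then show ?thesis ..
qed

definition closed_sets :: "'x::topological_space set set" where
  "closed_sets = {A. closed A \<and> A \<noteq> {}}"

definition hyper_ball :: "'x::topological_space set \<Rightarrow> 'x set set \<Rightarrow> 'x set set" where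
  "hyper_ball A \<U> = {B \<in> closed_sets. A \<subseteq> star B \<U> \<and> B \<subseteq> star A \<U>}"

definition hyper_entourage :: "'x::topological_space set set \<Rightarrow> ('x set \<times> 'x set) set" where
  "hyper_entourage \<U> = (\<Union>A\<in>closed_sets. hyper_ball A \<U> \<times> hyper_ball A \<U>)"

definition hyper_uniformity ::
    "'x::topological_space set set set \<Rightarrow> ('x set \<times> 'x set) filter" where
  "hyper_uniformity \<O> = (INF \<U>\<in>\<O>. principal (hyper_entourage \<U>))"

text \<open>The topology induced by a uniformity, as in class \<^class>\<open>open_uniformity\<close>.\<close>

definition hyper_topology :: "'x::topological_space set set set \<Rightarrow> 'x set topology" where
  "hyper_topology \<O> = topology (\<lambda>\<G>. \<G> \<subseteq> closed_sets \<and>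
     (\<forall>A\<in>\<G>. eventually (\<lambda>(A', B). A' = A \<longrightarrow> B \<in> \<G>) (hyper_uniformity \<O>)))"

lemma openin_hyper_topology:
  "openin (hyper_topology \<O>) \<G> \<longleftrightarrow> \<G> \<subseteq> closed_sets \<and>
     (\<forall>A\<in>\<G>. eventually (\<lambda>(A', B). A' = A \<longrightarrow> B \<in> \<G>) (hyper_uniformity \<O>))"
proof -
  have "istopology (\<lambda>\<G>. \<G> \<subseteq> closed_sets \<and>
     (\<forall>A\<in>\<G>. eventually (\<lambda>(A', B). A' = A \<longrightarrow> B \<in> \<G>) (hyper_uniformity \<O>)))"
    unfolding istopology_def
  proof (intro conjI allI impI ballI)
    fix \<G> \<H> A
    assume \<G>: "\<G> \<subseteq> closed_sets \<and>
        (\<forall>A\<in>\<G>. eventually (\<lambda>(A', B). A' = A \<longrightarrow> B \<in> \<G>) (hyper_uniformity \<O>))"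
      and \<H>: "\<H> \<subseteq> closed_sets \<and>
        (\<forall>A\<in>\<H>. eventually (\<lambda>(A', B). A' = A \<longrightarrow> B \<in> \<H>) (hyper_uniformity \<O>))"
    show "\<G> \<inter> \<H> \<subseteq> closed_sets" using \<G> by blast
    assume "A \<in> \<G> \<inter> \<H>"
    then have "eventually (\<lambda>(A', B). A' = A \<longrightarrow> B \<in> \<G>) (hyper_uniformity \<O>)"
      "eventually (\<lambda>(A', B). A' = A \<longrightarrow> B \<in> \<H>) (hyper_uniformity \<O>)"
      using \<G> \<H> by blast+
    then show "eventually (\<lambda>(A', B). A' = A \<longrightarrow> B \<in> \<G> \<inter> \<H>) (hyper_uniformity \<O>)"
      by eventually_elim auto
  next
    fix \<K> A
    assume \<K>: "\<forall>\<G>\<in>\<K>. \<G> \<subseteq> closed_sets \<and>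
        (\<forall>A\<in>\<G>. eventually (\<lambda>(A', B). A' = A \<longrightarrow> B \<in> \<G>) (hyper_uniformity \<O>))"
    show "\<Union>\<K> \<subseteq> closed_sets" using \<K> by blast
    assume "A \<in> \<Union>\<K>"
    then obtain \<G> where "\<G> \<in> \<K>" "A \<in> \<G>" by blast
    then have "eventually (\<lambda>(A', B). A' = A \<longrightarrow> B \<in> \<G>) (hyper_uniformity \<O>)"
      using \<K> by blast
    then show "eventually (\<lambda>(A', B). A' = A \<longrightarrow> B \<in> \<Union>\<K>) (hyper_uniformity \<O>)"
      by eventually_elim (use \<open>\<G> \<in> \<K>\<close> in auto)
  qed
  then show ?thesis
    unfolding hyper_topology_def by (simp add: topology_inverse')
qed

lemma cov_refines_if_half_refines:
  assumes "half_refines \<V> \<U>" and "\<U> \<noteq> {}"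
  shows "cov_refines \<V> \<U>"
  unfolding cov_refines_def
proof
  fix V assume "V \<in> \<V>"
  show "\<exists>U\<in>\<U>. V \<subseteq> U"
  proof (cases "V = {}")
    case True
    then show ?thesis using assms(2) by blast
  next
    case False
    then have "V \<inter> V \<noteq> {}" by simp
    then have "\<exists>U\<in>\<U>. V \<union> V \<subseteq> U"
      using assms(1) \<open>V \<in> \<V>\<close> unfolding half_refines_def by meson
    then show ?thesis by simp
  qed
qed

lemma admissible_nonempty:
  fixes \<O> :: "'x::topological_space set set set"
  assumes "admissible \<O>"
  shows "\<O> \<noteq> {}"
proof
  assume "\<O> = {}"
  then have "topological_basis ({} :: 'x set set)"
    using assms by (simp add: admissible_def)
  then have "(UNIV :: 'x set) = {}"
    unfolding topological_basis_def by (metis Union_empty open_UNIV subset_empty)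
  then show False by simp
qed

lemma admissible_common_refinement:
  assumes "admissible \<O>" and "\<U> \<in> \<O>" and "\<V> \<in> \<O>"
  shows "\<exists>\<W>\<in>\<O>. cov_refines \<W> \<U> \<and> cov_refines \<W> \<V>"
proof -
  have "\<W> \<noteq> {}" if "\<W> \<in> \<O>" for \<W>
    using assms(1) that by (auto simp: admissible_def open_covering_def)
  then show ?thesis
    using assms cov_refines_if_half_refines unfolding admissible_def by meson
qed

lemma hyper_entourage_mono:
  assumes "cov_refines \<V> \<U>"
  shows "hyper_entourage \<V> \<subseteq> hyper_entourage \<U>"
proof -
  have "star Y \<V> \<subseteq> star Y \<U>" for Y
  proof
    fix z assume "z \<in> star Y \<V>"
    then obtain V where V: "V \<in> \<V>" "Y \<inter> V \<noteq> {}" "z \<in> V"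
      unfolding star_def by blast
    then obtain U where "U \<in> \<U>" "V \<subseteq> U"
      using assms unfolding cov_refines_def by meson
    with V show "z \<in> star Y \<U>" unfolding star_def by blast
  qed
  then have "hyper_ball A \<V> \<subseteq> hyper_ball A \<U>" for A
    unfolding hyper_ball_def by (auto dest: subsetD)
  then have "hyper_ball A \<V> \<times> hyper_ball A \<V> \<subseteq> hyper_ball A \<U> \<times> hyper_ball A \<U>" for A
    by (meson Sigma_mono)
  then show ?thesis
    unfolding hyper_entourage_def by (meson UN_mono subset_refl)
qed

lemma eventually_hyper_uniformity:
  assumes "admissible \<O>"
  shows "eventually P (hyper_uniformity \<O>) \<longleftrightarrow> (\<exists>\<U>\<in>\<O>. \<forall>p\<in>hyper_entourage \<U>. P p)"
proof -
  have "\<exists>\<W>\<in>\<O>. principal (hyper_entourage \<W>) \<le>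
      inf (principal (hyper_entourage \<U>)) (principal (hyper_entourage \<V>))"
    if "\<U> \<in> \<O>" "\<V> \<in> \<O>" for \<U> \<V>
  proof -
    obtain \<W> where "\<W> \<in> \<O>" "cov_refines \<W> \<U>" "cov_refines \<W> \<V>"
      using admissible_common_refinement[OF assms \<open>\<U> \<in> \<O>\<close> \<open>\<V> \<in> \<O>\<close>] by blast
    then show ?thesis
      using hyper_entourage_mono by (intro bexI[of _ \<W>]) auto
  qed
  then show ?thesis
    unfolding hyper_uniformity_def using admissible_nonempty[OF assms]
    by (subst eventually_INF_base) (auto simp: eventually_principal)
qed

lemma topspace_hyper_topology:
  assumes "admissible \<O>"
  shows "topspace (hyper_topology \<O>) = closed_sets"
proof
  show "topspace (hyper_topology \<O>) \<subseteq> closed_sets"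
    unfolding topspace_def by (auto simp: openin_hyper_topology)
  have "hyper_entourage \<U> \<subseteq> UNIV \<times> closed_sets" for \<U>
    by (auto simp: hyper_entourage_def hyper_ball_def)
  then have "openin (hyper_topology \<O>) closed_sets"
    unfolding openin_hyper_topology eventually_hyper_uniformity[OF assms]
    using admissible_nonempty[OF assms] by fastforce
  then show "closed_sets \<subseteq> topspace (hyper_topology \<O>)"
    by (rule openin_subset)
qed

definition semigroup_action ::
    "('s::topological_semigroup_mult \<Rightarrow> 'x::topological_space \<Rightarrow> 'x) \<Rightarrow> bool" where
  "semigroup_action act \<longleftrightarrow>
     continuous_on UNIV (\<lambda>(s, x). act s x) \<and> (\<forall>s t x. act s (act t x) = act (s * t) x)"

definition act_set :: "('s \<Rightarrow> 'x \<Rightarrow> 'x) \<Rightarrow> 's set \<Rightarrow> 'x set \<Rightarrow> 'x set" where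
  "act_set act A Y = {act s y | s y. s \<in> A \<and> y \<in> Y}"

definition filter_basis :: "'s set set \<Rightarrow> bool" where
  "filter_basis \<F> \<longleftrightarrow>
     \<F> \<noteq> {} \<and> {} \<notin> \<F> \<and> (\<forall>A\<in>\<F>. \<forall>B\<in>\<F>. \<exists>C\<in>\<F>. C \<subseteq> A \<inter> B)"

definition prolongation ::
    "('s \<Rightarrow> 'x::topological_space \<Rightarrow> 'x) \<Rightarrow> 'x set set set \<Rightarrow> 's set \<Rightarrow> 'x \<Rightarrow> 'x set" where
  "prolongation act \<O> A x = (\<Inter>\<U>\<in>\<O>. closure (act_set act A (star {x} \<U>)))"

definition prolongational_limit_set ::
    "('s \<Rightarrow> 'x::topological_space \<Rightarrow> 'x) \<Rightarrow> 'x set set set \<Rightarrow> 's set set \<Rightarrow> 'x \<Rightarrow> 'x set" where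
  "prolongational_limit_set act \<O> \<F> x = (\<Inter>A\<in>\<F>. prolongation act \<O> A x)"

definition limit_compact ::
    "('s \<Rightarrow> 'x \<Rightarrow> 'x) \<Rightarrow> 'x set set set \<Rightarrow> 's set set \<Rightarrow> bool" where
  "limit_compact act \<O> \<F> \<longleftrightarrow>
     (\<forall>Y. cov_bounded \<O> Y \<longrightarrow>
        (\<forall>\<U>\<in>\<O>. \<exists>A\<in>\<F>. \<U> \<in> noncompactness \<O> (act_set act A Y)))"

definition index_le :: "'s set \<times> 'x set set \<Rightarrow> 's set \<times> 'x set set \<Rightarrow> bool" where
  "index_le p q \<longleftrightarrow> fst q \<subseteq> fst p \<and> cov_refines (snd q) (snd p)"

lemma directed_on_index_le:
  assumes "filter_basis \<F>" and "admissible \<O>"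
  shows "directed_on (\<F> \<times> \<O>) index_le"
  unfolding directed_on_def
proof (intro conjI ballI impI)
  show "\<F> \<times> \<O> \<noteq> {}"
    using assms admissible_nonempty by (auto simp: filter_basis_def)
next
  fix p q assume "p \<in> \<F> \<times> \<O>" "q \<in> \<F> \<times> \<O>"
  moreover then obtain C where "C \<in> \<F>" "C \<subseteq> fst p \<inter> fst q"
    using assms(1) unfolding filter_basis_def by (metis mem_Times_iff)
  moreover obtain \<W> where "\<W> \<in> \<O>" "cov_refines \<W> (snd p)" "cov_refines \<W> (snd q)"
    using admissible_common_refinement[OF assms(2)] calculation by (metis mem_Times_iff)
  ultimately show "\<exists>r\<in>\<F> \<times> \<O>. index_le p r \<and> index_le q r"
    by (intro bexI[of _ "(C, \<W>)"]) (auto simp: index_le_def)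
next
  fix p q r :: "'a set \<times> 'b set set"
  assume "index_le p q" "index_le q r"
  then show "index_le p r"
    unfolding index_le_def cov_refines_def by (meson subset_trans)
qed (auto simp: index_le_def cov_refines_def)

lemma closure_act_set_in_closed_sets:
  assumes "filter_basis \<F>" and "admissible \<O>" and "A \<in> \<F>" and "\<U> \<in> \<O>"
  shows "closure (act_set act A (star {x} \<U>)) \<in> closed_sets"
proof -
  have "\<Union>\<U> = UNIV"
    using assms unfolding admissible_def open_covering_def by blast
  then have "x \<in> star {x} \<U>"
    by (auto simp: star_def)
  moreover have "A \<noteq> {}"
    using assms by (auto simp: filter_basis_def)
  ultimately show ?thesis
    by (auto simp: closed_sets_def act_set_def)
qed

end

theory Submission
  imports Defs
begin

text \<open>
  The sets \<open>cls(A St[x, \<U>])\<close> form a family of nonempty closed sets directed by reverse inclusion,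
  and \<open>J\<^sub>\<F>(x)\<close> is its intersection. The theorem is Cantor's intersection theorem in Kuratowski's
  form for such a family: in a complete space, a decreasing family of nonempty closed sets whose
  measure of noncompactness tends to zero has a nonempty compact intersection, and it is eventually
  inside every open neighbourhood of that intersection (\<open>Cantor_Kuratowski\<close>).

  All three parts of that theorem are one statement about filters: every proper filter that
  eventually lies in each member of the family has a cluster point in the intersection. Indeed, pass
  to an ultrafilter. For each covering \<open>\<U>\<close> it contains a finite union of \<open>\<U>\<close>-small sets, hence one
  of these sets; so it is Cauchy and converges by completeness. Applied to filters on the
  intersection, this is compactness. Applied to the traces of the family outside an open
  neighbourhood of the intersection, it says that some trace is empty, which is the inclusion in the
  neighbourhood; nonemptiness is the case of the empty neighbourhood.

  Limit compactness makes the measure of noncompactness of the family vanish, because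
  \<open>St[x, \<V>]\<close> is bounded as soon as \<open>\<V> \<le> 1/2 \<U>\<close> for some \<open>\<U>\<close>, and because closures of small sets
  are small (\<open>cov_diam_closure\<close>). Convergence in the hyperspace follows by applying the last part to
  the open neighbourhood \<open>St[J\<^sub>\<F>(x), \<U>]\<close>; the reverse inclusion holds since \<open>J\<^sub>\<F>(x)\<close> lies in every
  member of the family.
\<close>

section \<open>Ultrafilters\<close>

text \<open>
  An ultrafilter is a minimal proper filter: if neither a set nor its complement belonged to it,
  adding the set would give a strictly finer proper filter. Zorn's lemma applies because the
  infimum of a chain of proper filters is proper.
\<close>

lemma ultrafilter_below:
  fixes F :: "'a filter"
  assumes "F \<noteq> bot"
  obtains M where "M \<le> F" and "M \<noteq> bot"
    and "\<And>P. eventually P M \<or> eventually (\<lambda>x. \<not> P x) M"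
proof -
  define \<A> where "\<A> = {G. G \<noteq> bot \<and> G \<le> F}"
  define R where "R = relation_of (\<lambda>(G :: 'a filter) H. H \<le> G) \<A>"
  have "partial_order_on \<A> R"
    unfolding R_def by (rule partial_order_on_relation_ofI) auto
  moreover have "\<exists>L\<in>\<A>. \<forall>G\<in>C. L \<le> G" if C: "C \<in> Chains R" for C
  proof (cases "C = {}")
    case True
    then show ?thesis
      using assms by (auto simp: \<A>_def)
  next
    case False
    have sub: "C \<subseteq> \<A>" and lin: "\<And>G H. G \<in> C \<Longrightarrow> H \<in> C \<Longrightarrow> H \<le> G \<or> G \<le> H"
      using C by (auto simp: Chains_def R_def relation_of_def)
    have "eventually P (Inf C) \<longleftrightarrow> (\<exists>G\<in>C. eventually P G)" for P
      using False lin by (intro eventually_Inf_base) (metis inf.absorb1 inf.absorb2 order_refl)+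
    then have "Inf C \<noteq> bot"
      using sub unfolding \<A>_def trivial_limit_def by blast
    moreover have "Inf C \<le> F"
      using False sub unfolding \<A>_def by (blast intro: Inf_lower2)
    ultimately show ?thesis
      by (intro bexI[of _ "Inf C"]) (auto simp: \<A>_def intro: Inf_lower)
  qed
  ultimately obtain M where M: "M \<in> \<A>" and min: "\<And>G. G \<in> \<A> \<Longrightarrow> G \<le> M \<Longrightarrow> G = M"
    unfolding R_def using predicate_Zorn[of \<A> "\<lambda>G H. H \<le> G"] by metis
  have "eventually P M \<or> eventually (\<lambda>x. \<not> P x) M" for P
  proof (cases "inf M (principal {x. P x}) = bot")
    case True
    then show ?thesis
      by (simp add: trivial_limit_def eventually_inf_principal)
  next
    case False
    moreover have "inf M (principal {x. P x}) \<le> F"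
      using M by (auto simp: \<A>_def intro: le_infI1)
    ultimately have "inf M (principal {x. P x}) = M"
      using min by (simp add: \<A>_def)
    moreover have "eventually P (inf M (principal {x. P x}))"
      by (simp add: eventually_inf_principal)
    ultimately show ?thesis
      by simp
  qed
  with M show thesis
    by (intro that[of M]) (auto simp: \<A>_def)
qed

lemma ultrafilter_finite_Union:
  assumes ultra: "\<And>P. eventually P M \<or> eventually (\<lambda>x. \<not> P x) M"
    and "M \<noteq> bot" and "finite \<X>" and "eventually (\<lambda>x. x \<in> \<Union>\<X>) M"
  shows "\<exists>Z\<in>\<X>. eventually (\<lambda>x. x \<in> Z) M"
proof (rule ccontr)
  assume "\<not> ?thesis"
  then have "\<forall>Z\<in>\<X>. eventually (\<lambda>x. x \<notin> Z) M"
    using ultra by blast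
  then have "eventually (\<lambda>x. \<forall>Z\<in>\<X>. x \<notin> Z) M"
    using \<open>finite \<X>\<close> by (simp add: eventually_ball_finite)
  then have "eventually (\<lambda>x. False) M"
    using assms(4) by eventually_elim blast
  with \<open>M \<noteq> bot\<close> show False
    by (simp add: trivial_limit_def)
qed

section \<open>Coverings and small sets\<close>

lemma subset_star:
  assumes "admissible \<O>" and "\<U> \<in> \<O>"
  shows "Y \<subseteq> star Y \<U>"
proof
  fix y assume "y \<in> Y"
  have "y \<in> \<Union>\<U>"
    using assms by (simp add: admissible_def open_covering_def)
  then obtain U where "U \<in> \<U>" "y \<in> U"
    by blast
  with \<open>y \<in> Y\<close> show "y \<in> star Y \<U>"
    unfolding star_def by blast
qed

lemma half_refinesE:
  assumes "half_refines \<V> \<U>" and "P \<in> \<V>" and "Q \<in> \<V>" and "a \<in> P" and "a \<in> Q"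
  obtains U where "U \<in> \<U>" and "P \<union> Q \<subseteq> U"
proof -
  have "P \<inter> Q \<noteq> {}"
    using assms(4,5) by blast
  then show thesis
    using assms(1-3) that unfolding half_refines_def by meson
qed

lemma mem_cov_diam_iff:
  assumes "\<U> \<in> \<O>"
  shows "\<U> \<in> cov_diam \<O> Z \<longleftrightarrow> (\<forall>y\<in>Z. \<forall>z\<in>Z. z \<in> star {y} \<U>)"
  using assms by (auto simp: cov_diam_def rho_def)

text \<open>
  A point of the closure shares a member of \<open>\<W>\<close> with a point of the set, so two points of the
  closure are joined by a chain of three members of \<open>\<W>\<close>. Two half-refinements absorb such a
  chain: consecutive members merge into two sets that both contain the middle one.
\<close>

lemma cov_diam_closure:
  fixes \<O> :: "'x::topological_space set set set"
  assumes adm: "admissible \<O>" and \<U>: "\<U> \<in> \<O>"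
  obtains \<W> where "\<W> \<in> \<O>"
    and "\<And>Z. \<W> \<in> cov_diam \<O> Z \<Longrightarrow> \<U> \<in> cov_diam \<O> (closure Z)"
proof -
  have half: "\<exists>\<V>'\<in>\<O>. half_refines \<V>' \<V>" if "\<V> \<in> \<O>" for \<V>
    using adm that unfolding admissible_def by blast
  obtain \<V> where \<V>: "\<V> \<in> \<O>" "half_refines \<V> \<U>"
    using half[OF \<U>] by blast
  obtain \<W> where \<W>: "\<W> \<in> \<O>" "half_refines \<W> \<V>"
    using half[OF \<V>(1)] by blast
  have near: "\<exists>a\<in>Z. \<exists>P\<in>\<W>. y \<in> P \<and> a \<in> P" if "y \<in> closure Z" for y Z
  proof -
    obtain P where P: "P \<in> \<W>" "y \<in> P"
      using subset_star[OF adm \<W>(1), of "{y}"] by (auto simp: star_def)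
    have "open P"
      using adm \<W>(1) P(1) by (auto simp: admissible_def open_covering_def)
    then have "P \<inter> Z \<noteq> {}"
      using that P(2) open_Int_closure_eq_empty[of P Z] by blast
    with P show ?thesis
      by blast
  qed
  have "\<U> \<in> cov_diam \<O> (closure Z)" if Z: "\<W> \<in> cov_diam \<O> Z" for Z
    unfolding mem_cov_diam_iff[OF \<U>]
  proof (intro ballI)
    fix y z assume "y \<in> closure Z" "z \<in> closure Z"
    obtain a P where P: "a \<in> Z" "P \<in> \<W>" "y \<in> P" "a \<in> P"
      using near[OF \<open>y \<in> closure Z\<close>] by blast
    obtain b R where R: "b \<in> Z" "R \<in> \<W>" "z \<in> R" "b \<in> R"
      using near[OF \<open>z \<in> closure Z\<close>] by blast
    have "b \<in> star {a} \<W>"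
      using Z P(1) R(1) unfolding mem_cov_diam_iff[OF \<W>(1)] by blast
    then obtain Q where Q: "Q \<in> \<W>" "a \<in> Q" "b \<in> Q"
      by (auto simp: star_def)
    obtain P' where P': "P' \<in> \<V>" "P \<union> Q \<subseteq> P'"
      using half_refinesE[OF \<W>(2) P(2) Q(1) P(4) Q(2)] .
    obtain R' where R': "R' \<in> \<V>" "Q \<union> R \<subseteq> R'"
      using half_refinesE[OF \<W>(2) Q(1) R(2) Q(3) R(4)] .
    have "a \<in> P'" "a \<in> R'"
      using P(4) P'(2) Q(2) R'(2) by auto
    then obtain U where "U \<in> \<U>" "P' \<union> R' \<subseteq> U"
      using half_refinesE[OF \<V>(2) P'(1) R'(1)] by blast
    moreover have "y \<in> P'" "z \<in> R'"
      using P(3) P'(2) R(3) R'(2) by auto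
    ultimately show "z \<in> star {y} \<U>"
      unfolding star_def by blast
  qed
  with \<W>(1) show thesis
    by (rule that)
qed

text \<open>
  Two members through \<open>x\<close> meet, so a half-refinement \<open>\<V>\<close> of \<open>\<U>\<close> puts their union into a member of
  \<open>\<U>\<close>. An arbitrary \<open>\<V> \<in> \<O>\<close> need not half-refine a member of \<open>\<O>\<close>, hence the existential form.
\<close>

lemma exists_bounded_star:
  assumes adm: "admissible \<O>"
  obtains \<V> where "\<V> \<in> \<O>" and "\<And>x. cov_bounded \<O> (star {x} \<V>)"
proof -
  obtain \<U> where \<U>: "\<U> \<in> \<O>"
    using admissible_nonempty[OF adm] by blast
  then obtain \<V> where \<V>: "\<V> \<in> \<O>" "half_refines \<V> \<U>"
    using adm unfolding admissible_def by blast
  have "cov_bounded \<O> (star {x} \<V>)" for x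
    unfolding cov_bounded_def
  proof (intro conjI bexI[OF _ \<U>] ballI)
    show "star {x} \<V> \<noteq> {}"
      using subset_star[OF adm \<V>(1), of "{x}"] by blast
    fix y z assume "y \<in> star {x} \<V>" "z \<in> star {x} \<V>"
    then obtain P Q where PQ: "P \<in> \<V>" "Q \<in> \<V>" "x \<in> P" "x \<in> Q" "y \<in> P" "z \<in> Q"
      by (auto simp: star_def)
    obtain U where "U \<in> \<U>" "P \<union> Q \<subseteq> U"
      using half_refinesE[OF \<V>(2) PQ(1-4)] .
    then show "\<U> \<in> rho \<O> y z"
      using PQ \<U> by (auto simp: rho_def star_def)
  qed
  with \<V>(1) show thesis
    by (rule that)
qed

section \<open>Cantor's intersection theorem\<close>

text \<open>
  Completeness speaks of nets. A filter becomes a net on the pairs of a member and one of its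
  points, mapped to that point; the values on its tails are exactly the members of the filter.
\<close>

lemma Cauchy_filter_converges:
  fixes \<O> :: "'x::topological_space set set set"
  assumes compl: "complete_admissible \<O>" and "M \<noteq> bot"
    and Cauchy: "\<And>\<U>. \<U> \<in> \<O> \<Longrightarrow> \<exists>Z. eventually (\<lambda>x. x \<in> Z) M \<and> \<U> \<in> cov_diam \<O> Z"
  shows "\<exists>l. M \<le> nhds l"
proof -
  define I where "I = {(Z, z) | Z z. eventually (\<lambda>x. x \<in> Z) M \<and> z \<in> Z}"
  define le where "le = (\<lambda>(p :: 'x set \<times> 'x) (q :: 'x set \<times> 'x). fst q \<subseteq> fst p)"
  have pick: "\<exists>z. (Z, z) \<in> I" if "eventually (\<lambda>x. x \<in> Z) M" for Z
    using that eventually_happens'[OF \<open>M \<noteq> bot\<close> that] by (auto simp: I_def)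
  have dir: "directed_on I le"
    unfolding directed_on_def
  proof (intro conjI ballI)
    show "I \<noteq> {}"
      using pick[of UNIV] by auto
    fix p q assume "p \<in> I" "q \<in> I"
    then have "eventually (\<lambda>x. x \<in> fst p \<inter> fst q) M"
      by (auto simp: I_def eventually_conj_iff)
    then obtain z where "(fst p \<inter> fst q, z) \<in> I"
      using pick by blast
    then show "\<exists>r\<in>I. le p r \<and> le q r"
      by (intro bexI[of _ "(fst p \<inter> fst q, z)"]) (auto simp: le_def)
  qed (auto simp: le_def)
  have "cov_Cauchy \<O> I le snd"
    unfolding cov_Cauchy_def
  proof
    fix \<U> assume "\<U> \<in> \<O>"
    then obtain Z where Z: "eventually (\<lambda>x. x \<in> Z) M" "\<U> \<in> cov_diam \<O> Z"
      using Cauchy by blast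
    obtain z where "(Z, z) \<in> I"
      using pick[OF Z(1)] by blast
    then show "\<exists>i\<in>I. \<forall>j\<in>I. \<forall>k\<in>I. le i j \<longrightarrow> le i k \<longrightarrow> \<U> \<in> rho \<O> (snd j) (snd k)"
      using Z(2) by (intro bexI[of _ "(Z, z)"]) (auto simp: I_def le_def cov_diam_def)
  qed
  with compl dir obtain l where l: "(snd \<longlongrightarrow> l) (net_filter I le)"
    unfolding complete_admissible_def by blast
  have "eventually (\<lambda>x. x \<in> V) M" if "open V" "l \<in> V" for V
  proof -
    have "eventually (\<lambda>p. snd p \<in> V) (net_filter I le)"
      using l that by (rule topological_tendstoD)
    then obtain p where p: "p \<in> I" "\<And>q. q \<in> I \<Longrightarrow> le p q \<Longrightarrow> snd q \<in> V"
      unfolding eventually_net_filter[OF dir] by blast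
    have "fst p \<subseteq> V"
    proof
      fix z assume "z \<in> fst p"
      then show "z \<in> V"
        using p(1) p(2)[of "(fst p, z)"] by (auto simp: I_def le_def)
    qed
    moreover have "eventually (\<lambda>x. x \<in> fst p) M"
      using p(1) by (auto simp: I_def)
    ultimately show ?thesis
      by (auto elim: eventually_mono)
  qed
  then have "M \<le> nhds l"
    unfolding le_filter_def eventually_nhds by (blast intro: eventually_mono)
  then show ?thesis ..
qed

text \<open>
  The filter form of the statement that a complete totally bounded space is compact.
\<close>

lemma totally_bounded_filter_clusters:
  fixes \<O> :: "'x::topological_space set set set"
  assumes compl: "complete_admissible \<O>" and "F \<noteq> bot"
    and tb: "\<And>\<U>. \<U> \<in> \<O> \<Longrightarrow>
      \<exists>\<X>. finite \<X> \<and> eventually (\<lambda>x. x \<in> \<Union>\<X>) F \<and> (\<forall>Z\<in>\<X>. \<U> \<in> cov_diam \<O> Z)"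
  shows "\<exists>l. inf (nhds l) F \<noteq> bot"
proof -
  obtain M where M: "M \<le> F" "M \<noteq> bot"
    and ultra: "\<And>P. eventually P M \<or> eventually (\<lambda>x. \<not> P x) M"
    using ultrafilter_below[OF \<open>F \<noteq> bot\<close>] by blast
  have "\<exists>Z. eventually (\<lambda>x. x \<in> Z) M \<and> \<U> \<in> cov_diam \<O> Z" if \<U>: "\<U> \<in> \<O>" for \<U>
  proof -
    obtain \<X> where \<X>: "finite \<X>" "eventually (\<lambda>x. x \<in> \<Union>\<X>) F" "\<forall>Z\<in>\<X>. \<U> \<in> cov_diam \<O> Z"
      using tb[OF \<U>] by blast
    have "eventually (\<lambda>x. x \<in> \<Union>\<X>) M"
      using M(1) \<X>(2) by (rule filter_leD)
    then show ?thesis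
      using ultrafilter_finite_Union[OF ultra M(2) \<X>(1)] \<X>(3) by blast
  qed
  then obtain l where "M \<le> nhds l"
    using Cauchy_filter_converges[OF compl M(2)] by blast
  then have "M \<le> inf (nhds l) F"
    using M(1) by simp
  then show ?thesis
    using M(2) by (metis bot.extremum_uniqueI)
qed

text \<open>
  Both compactness and the inclusion in a neighbourhood come from the claim \<open>cluster\<close>: a cluster
  point exists by total boundedness, and it lies in each member because the members are closed.
\<close>

theorem Cantor_Kuratowski:
  fixes \<O> :: "'x::topological_space set set set"
  assumes compl: "complete_admissible \<O>"
    and "\<K> \<noteq> {}"
    and closed: "\<And>K. K \<in> \<K> \<Longrightarrow> closed K"
    and nonempty: "\<And>K. K \<in> \<K> \<Longrightarrow> K \<noteq> {}"
    and dir: "\<And>K L. K \<in> \<K> \<Longrightarrow> L \<in> \<K> \<Longrightarrow> \<exists>M\<in>\<K>. M \<subseteq> K \<inter> L"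
    and small: "\<And>\<U>. \<U> \<in> \<O> \<Longrightarrow>
      \<exists>K\<in>\<K>. \<exists>\<X>. finite \<X> \<and> K \<subseteq> \<Union>\<X> \<and> (\<forall>Z\<in>\<X>. \<U> \<in> cov_diam \<O> Z)"
  shows "\<Inter>\<K> \<noteq> {}" and "compact (\<Inter>\<K>)"
    and "\<And>V. open V \<Longrightarrow> \<Inter>\<K> \<subseteq> V \<Longrightarrow> \<exists>K\<in>\<K>. K \<subseteq> V"
proof -
  have cluster: "\<exists>l\<in>\<Inter>\<K>. inf (nhds l) F \<noteq> bot"
    if "F \<noteq> bot" and F: "\<And>K. K \<in> \<K> \<Longrightarrow> eventually (\<lambda>x. x \<in> K) F" for F
  proof -
    have "\<exists>\<X>. finite \<X> \<and> eventually (\<lambda>x. x \<in> \<Union>\<X>) F \<and> (\<forall>Z\<in>\<X>. \<U> \<in> cov_diam \<O> Z)"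
      if \<U>: "\<U> \<in> \<O>" for \<U>
    proof -
      obtain K \<X> where "K \<in> \<K>" and \<X>: "finite \<X>" "K \<subseteq> \<Union>\<X>" "\<forall>Z\<in>\<X>. \<U> \<in> cov_diam \<O> Z"
        using small[OF \<U>] by blast
      have "eventually (\<lambda>x. x \<in> \<Union>\<X>) F"
        using F[OF \<open>K \<in> \<K>\<close>] by (rule eventually_mono) (use \<X>(2) in blast)
      with \<X> show ?thesis
        by blast
    qed
    then obtain l where l: "inf (nhds l) F \<noteq> bot"
      using totally_bounded_filter_clusters[OF compl \<open>F \<noteq> bot\<close>] by blast
    have "l \<in> K" if K: "K \<in> \<K>" for K
    proof (rule ccontr)
      assume "l \<notin> K"
      then have "eventually (\<lambda>x. x \<in> - K) (nhds l)"
        using closed[OF K] by (intro eventually_nhds_in_open) auto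
      with F[OF K] have "eventually (\<lambda>x. False) (inf (nhds l) F)"
        unfolding eventually_inf by (intro exI[of _ "\<lambda>x. x \<in> - K"] exI[of _ "\<lambda>x. x \<in> K"]) auto
      with l show False
        by (simp add: trivial_limit_def)
    qed
    with l show ?thesis
      by blast
  qed
  have trace: "\<exists>K\<in>\<K>. K \<subseteq> V" if "open V" "\<Inter>\<K> \<subseteq> V" for V
  proof (rule ccontr)
    \<comment> \<open>The traces outside \<open>V\<close> generate a proper filter whose cluster points avoid \<open>V\<close>.\<close>
    assume none: "\<not> ?thesis"
    define F where "F = (INF K\<in>\<K>. principal (K - V))"
    have ev: "eventually P F \<longleftrightarrow> (\<exists>K\<in>\<K>. \<forall>x\<in>K - V. P x)" for P
      unfolding F_def
    proof (subst eventually_INF_base)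
      fix K L assume "K \<in> \<K>" "L \<in> \<K>"
      then obtain M where "M \<in> \<K>" "M \<subseteq> K \<inter> L"
        using dir by blast
      then show "\<exists>x\<in>\<K>. principal (x - V) \<le> inf (principal (K - V)) (principal (L - V))"
        by (intro bexI[of _ M]) auto
    qed (use \<open>\<K> \<noteq> {}\<close> in \<open>auto simp: eventually_principal\<close>)
    have "F \<noteq> bot"
      using none unfolding trivial_limit_def ev by blast
    moreover have "eventually (\<lambda>x. x \<in> K) F" if "K \<in> \<K>" for K
      using that unfolding ev by blast
    ultimately obtain l where l: "l \<in> \<Inter>\<K>" "inf (nhds l) F \<noteq> bot"
      using cluster by blast
    have "eventually (\<lambda>x. x \<in> V) (nhds l)"
      using that l(1) by (intro eventually_nhds_in_open) auto
    moreover have "eventually (\<lambda>x. x \<notin> V) F"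
      using \<open>\<K> \<noteq> {}\<close> unfolding ev by blast
    ultimately have "eventually (\<lambda>x. False) (inf (nhds l) F)"
      unfolding eventually_inf by (intro exI[of _ "\<lambda>x. x \<in> V"] exI[of _ "\<lambda>x. x \<notin> V"]) auto
    with l(2) show False
      by (simp add: trivial_limit_def)
  qed
  then show "\<And>V. open V \<Longrightarrow> \<Inter>\<K> \<subseteq> V \<Longrightarrow> \<exists>K\<in>\<K>. K \<subseteq> V" .
  \<comment> \<open>An empty intersection would have the empty set as an open neighbourhood.\<close>
  show "\<Inter>\<K> \<noteq> {}"
    using trace[of "{}"] nonempty by auto
  show "compact (\<Inter>\<K>)"
    unfolding compact_filter
  proof (intro allI impI)
    fix F :: "'x filter"
    assume "F \<noteq> bot" and F: "eventually (\<lambda>x. x \<in> \<Inter>\<K>) F"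
    have "eventually (\<lambda>x. x \<in> K) F" if "K \<in> \<K>" for K
      using F by eventually_elim (use that in blast)
    with \<open>F \<noteq> bot\<close> show "\<exists>x\<in>\<Inter>\<K>. inf (nhds x) F \<noteq> bot"
      by (rule cluster)
  qed
qed

section \<open>Convergence in the hyperspace\<close>

lemma closure_act_star_mono:
  assumes "index_le (A, \<U>) (B, \<V>)"
  shows "closure (act_set act B (star {x} \<V>)) \<subseteq> closure (act_set act A (star {x} \<U>))"
proof (rule closure_mono)
  have "B \<subseteq> A" and "star {x} \<V> \<subseteq> star {x} \<U>"
    using assms by (fastforce simp: index_le_def cov_refines_def star_def)+
  then show "act_set act B (star {x} \<V>) \<subseteq> act_set act A (star {x} \<U>)"
    unfolding act_set_def by blast
qed

text \<open>
  The set \<open>J\<close> itself serves as the centre of the ball witnessing that \<open>J\<close> and \<open>K i\<close> are close.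
\<close>

lemma limitin_hyper_topologyI:
  assumes adm: "admissible \<O>" and J: "J \<in> closed_sets"
    and near: "\<And>\<U>. \<U> \<in> \<O> \<Longrightarrow> eventually (\<lambda>i. K i \<in> hyper_ball J \<U>) F"
  shows "limitin (hyper_topology \<O>) K J F"
  unfolding limitin_def topspace_hyper_topology[OF adm]
proof (intro conjI allI impI)
  show "J \<in> closed_sets" by (rule J)
  fix \<G> assume "openin (hyper_topology \<O>) \<G> \<and> J \<in> \<G>"
  then obtain \<U> where \<U>: "\<U> \<in> \<O>" "\<And>B. (J, B) \<in> hyper_entourage \<U> \<Longrightarrow> B \<in> \<G>"
    unfolding openin_hyper_topology eventually_hyper_uniformity[OF adm] by fastforce
  have "J \<in> hyper_ball J \<U>"
    using J subset_star[OF adm \<U>(1)] by (simp add: hyper_ball_def)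
  then have "B \<in> \<G>" if "B \<in> hyper_ball J \<U>" for B
    using \<U>(2) J that unfolding hyper_entourage_def by blast
  then show "eventually (\<lambda>i. K i \<in> \<G>) F"
    using near[OF \<U>(1)] by (auto elim: eventually_mono)
qed

theorem proposition13:
  fixes act :: "'s::topological_semigroup_mult \<Rightarrow> 'x::topological_space \<Rightarrow> 'x"
    and \<O> :: "'x set set set"
    and \<F> :: "'s set set"
  assumes "completely_regular_space (euclidean :: 'x topology)"
    and "admissible \<O>"
    and "semigroup_action act"
    and "filter_basis \<F>"
    and "complete_admissible \<O>"
    and "limit_compact act \<O> \<F>"
  shows "\<forall>x. prolongational_limit_set act \<O> \<F> x \<noteq> {} \<and>
    compact (prolongational_limit_set act \<O> \<F> x) \<and>
    limitin (hyper_topology \<O>)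
      (\<lambda>(A, \<U>). closure (act_set act A (star {x} \<U>)))
      (prolongational_limit_set act \<O> \<F> x)
      (net_filter (\<F> \<times> \<O>) index_le)"
proof
  fix x
  note adm = assms(2) and fb = assms(4) and compl = assms(5) and lc = assms(6)
  define K where "K = (\<lambda>(A, \<U>). closure (act_set act A (star {x} \<U>)))"
  let ?J = "prolongational_limit_set act \<O> \<F> x"
  have dir: "directed_on (\<F> \<times> \<O>) index_le"
    using fb adm by (rule directed_on_index_le)
  have K_closed: "K p \<in> closed_sets" if "p \<in> \<F> \<times> \<O>" for p
    using closure_act_set_in_closed_sets[OF fb adm] that by (auto simp: K_def)
  have K_mono: "K q \<subseteq> K p" if "index_le p q" for p q
    using that closure_act_star_mono by (cases p; cases q) (simp add: K_def)
  have J: "?J = \<Inter>(K ` (\<F> \<times> \<O>))"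
    by (auto simp: prolongational_limit_set_def prolongation_def K_def)
  \<comment> \<open>Limit compactness covers \<open>A St[x, \<V>]\<close> by \<open>\<W>\<close>-small sets; a finer \<open>\<W>\<close> than \<open>\<U>\<close> pays for the closure.\<close>
  have small: "\<exists>L\<in>K ` (\<F> \<times> \<O>). \<exists>\<X>. finite \<X> \<and> L \<subseteq> \<Union>\<X> \<and> (\<forall>Z\<in>\<X>. \<U> \<in> cov_diam \<O> Z)"
    if \<U>: "\<U> \<in> \<O>" for \<U>
  proof -
    obtain \<W> where \<W>: "\<W> \<in> \<O>" "\<And>Z. \<W> \<in> cov_diam \<O> Z \<Longrightarrow> \<U> \<in> cov_diam \<O> (closure Z)"
      using cov_diam_closure[OF adm \<U>] by blast
    obtain \<V> where \<V>: "\<V> \<in> \<O>" "cov_bounded \<O> (star {x} \<V>)"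
      using exists_bounded_star[OF adm] by blast
    obtain A where A: "A \<in> \<F>" "\<W> \<in> noncompactness \<O> (act_set act A (star {x} \<V>))"
      using lc \<V>(2) \<W>(1) unfolding limit_compact_def by blast
    then obtain \<X> where \<X>: "finite \<X>" "act_set act A (star {x} \<V>) \<subseteq> \<Union>\<X>"
        "\<forall>Z\<in>\<X>. \<W> \<in> cov_diam \<O> Z"
      unfolding noncompactness_def by blast
    have "\<Union>\<X> \<subseteq> \<Union>(closure ` \<X>)"
      using closure_subset by blast
    moreover have "closed (\<Union>(closure ` \<X>))"
      using \<X>(1) by (intro closed_Union) auto
    ultimately have "closure (act_set act A (star {x} \<V>)) \<subseteq> \<Union>(closure ` \<X>)"
      using \<X>(2) by (meson closure_minimal order_trans)
    then have "K (A, \<V>) \<subseteq> \<Union>(closure ` \<X>)"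
      by (simp add: K_def)
    then show ?thesis
      using A(1) \<V>(1) \<X> \<W>(2)
      by (intro bexI[of _ "K (A, \<V>)"] exI[of _ "closure ` \<X>"]) auto
  qed
  have down: "\<exists>M\<in>K ` (\<F> \<times> \<O>). M \<subseteq> L \<inter> L'"
    if L: "L \<in> K ` (\<F> \<times> \<O>)" "L' \<in> K ` (\<F> \<times> \<O>)" for L L'
  proof -
    obtain p q where pq: "p \<in> \<F> \<times> \<O>" "q \<in> \<F> \<times> \<O>" "L = K p" "L' = K q"
      using L by blast
    then obtain r where "r \<in> \<F> \<times> \<O>" "index_le p r" "index_le q r"
      using dir unfolding directed_on_def by meson
    then show ?thesis
      using K_mono pq by blast
  qed
  have ne: "K ` (\<F> \<times> \<O>) \<noteq> {}"
    using dir unfolding directed_on_def by blast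
  have members: "closed L" "L \<noteq> {}" if "L \<in> K ` (\<F> \<times> \<O>)" for L
    using that K_closed by (auto simp: closed_sets_def)
  note Cantor = Cantor_Kuratowski[OF compl ne members down small]
  have nonempty: "?J \<noteq> {}"
    unfolding J by (rule Cantor(1))
  have compact: "compact ?J"
    unfolding J by (rule Cantor(2))
  have nbhd: "\<exists>L\<in>K ` (\<F> \<times> \<O>). L \<subseteq> V" if "open V" "?J \<subseteq> V" for V
    using that unfolding J by (rule Cantor(3)[rotated 5])
  have J_closed: "?J \<in> closed_sets"
    using nonempty closed_Inter[of "K ` (\<F> \<times> \<O>)"] members(1) unfolding J closed_sets_def by blast
  have "eventually (\<lambda>p. K p \<in> hyper_ball ?J \<U>) (net_filter (\<F> \<times> \<O>) index_le)"
    if \<U>: "\<U> \<in> \<O>" for \<U>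
  proof -
    have sub: "Y \<subseteq> star Y \<U>" for Y
      using adm \<U> by (rule subset_star)
    have "open (star ?J \<U>)"
      using adm \<U> by (auto simp: admissible_def open_covering_def star_def)
    then obtain p where p: "p \<in> \<F> \<times> \<O>" "K p \<subseteq> star ?J \<U>"
      using nbhd[OF _ sub] by blast
    have "K q \<in> hyper_ball ?J \<U>" if "q \<in> \<F> \<times> \<O>" "index_le p q" for q
    proof -
      have "?J \<subseteq> K q"
        using that(1) unfolding J by blast
      then show ?thesis
        unfolding hyper_ball_def
        using K_closed[OF that(1)] K_mono[OF that(2)] p(2) sub[of "K q"] by blast
    qed
    then show ?thesis
      unfolding eventually_net_filter[OF dir] using p(1) by blast
  qed
  then have "limitin (hyper_topology \<O>) K ?J (net_filter (\<F> \<times> \<O>) index_le)"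
    by (rule limitin_hyper_topologyI[OF adm J_closed])
  with nonempty compact show "?J \<noteq> {} \<and> compact ?J \<and>
    limitin (hyper_topology \<O>) (\<lambda>(A, \<U>). closure (act_set act A (star {x} \<U>))) ?J
      (net_filter (\<F> \<times> \<O>) index_le)"
    by (simp add: K_def)
qed

end
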